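(* Let $N$ be a positive integer, let $B$ be the $N\times N$ real upper bidiagonal matrix with diagonal entries $\sqrt{q_1},\dots,\sqrt{q_N}$ and upper subdiagonal entries $\sqrt{e_1},\dots,\sqrt{e_{N-1}}$, where all $q_i>0$ and $e_i>0$. Let $\tilde g_i^{(M)}$ and $h_i^{(M)}$ ($i=1,\dots,N$, $M=1,2,\dots$) be the quantities attached to $B$ that are defined recursively in the context. Then for all $i=1,\dots,N$ and $M=2,3,\dots$, $$h_i^{(M)}=M!\cdot\tilde g_i^{(M)}.$$
   Context: The matrix $B$ has $(i,i)$-entry $\sqrt{q_i}$ ($i=1,\dots,N$), $(i,i+1)$-entry $\sqrt{e_i}$ ($i=1,\dots,N-1$), and all other entries zero. Convention: $\sum_{i=j}^{k}=0$ if $j>k$. ${}_pC_k$ denotes the binomial coefficient $\binom{p}{k}$. Put $\check B_i=1/q_i$ for $i=1,\dots,N$ and $\tilde F_i=e_{i-1}/q_i$ for $i=2,\dots,N$. Let $w_i^{(1)}$ denote the $(i,i)$-entry of $(BB^{\top})^{-1}$. The quantities $\tilde g_i^{(r)}$ for $i=1,\dots,N$ and $r=1,2,\dots$ are defined by: - $\tilde g_1^{(r)}=0$ for every positive integer $r$; - $\tilde g_i^{(1)}=\tilde F_i\,w_{i-1}^{(1)}$ for $i=2,\dots,N$; - $\tilde g_i^{(r)}=\tilde F_i\,\tilde g_{i-1}^{(r)}+\check B_{i-1}\,\tilde g_i^{(r-1)}+\sum_{k=1}^{r-1}\tilde g_{i-1}^{(k)}\,\tilde g_i^{(r-k)}$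 for $i=2,\dots,N$ and $r=2,3,\dots$. The quantities $h_i^{(p)}$ for $i=1,\dots,N$ and $p=1,2,\dots$ are defined by: - $h_1^{(1)}=1/q_1$; - $h_i^{(1)}=\tilde F_i\,h_{i-1}^{(1)}+1/q_i$ for $i=2,\dots,N$; - $h_1^{(p)}=0$ for $p=2,3,\dots$; - $h_i^{(p)}=\tilde F_i\left(h_{i-1}^{(p)}+p\,h_{i-1}^{(1)}h_{i-1}^{(p-1)}\right)+\sum_{k=1}^{p-2}{}_pC_k\,h_{i-1}^{(k)}h_i^{(p-k)}$ for $i=2,\dots,N$ and $p=2,3,\dots$. *)

theory Defs
  imports Complex_Main "Jordan_Normal_Form.Gauss_Jordan_Elimination"
begin

text \<open>
  Sequences \<open>q\<close>, \<open>e\<close> and the indices \<open>i\<close> are numbered from 1; matrix entries of the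
  library are numbered from 0, so the \<open>(i, j)\<close>-entry of \<open>A\<close> is \<open>A $$ (i - 1, j - 1)\<close>.
\<close>

definition bidiag :: "nat \<Rightarrow> (nat \<Rightarrow> real) \<Rightarrow> (nat \<Rightarrow> real) \<Rightarrow> real mat" where
  "bidiag N q e = mat N N (\<lambda>(r, c).
     if c = r then sqrt (q (r + 1))
     else if c = r + 1 then sqrt (e (r + 1))
     else 0)"

definition B_check :: "(nat \<Rightarrow> real) \<Rightarrow> nat \<Rightarrow> real" where
  "B_check q i = 1 / q i"

definition F_tilde :: "(nat \<Rightarrow> real) \<Rightarrow> (nat \<Rightarrow> real) \<Rightarrow> nat \<Rightarrow> real" where
  "F_tilde q e i = e (i - 1) / q i"

text \<open>\<open>mat_inverse\<close> returns \<open>None\<close> only for a singular matrix; here all \<open>q i > 0\<close> makes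
  \<open>B * B\<^sup>T\<close> nonsingular.\<close>

definition w1 :: "nat \<Rightarrow> (nat \<Rightarrow> real) \<Rightarrow> (nat \<Rightarrow> real) \<Rightarrow> nat \<Rightarrow> real" where
  "w1 N q e i =
     the (mat_inverse (bidiag N q e * transpose_mat (bidiag N q e))) $$ (i - 1, i - 1)"

text \<open>In the two recursions below the arguments are the index \<open>i\<close> and the order \<open>r\<close> (or \<open>p\<close>), both
  at least 1; the value 0 for a zero index or order is only a filler for totality.\<close>

function g_tilde :: "nat \<Rightarrow> (nat \<Rightarrow> real) \<Rightarrow> (nat \<Rightarrow> real) \<Rightarrow> nat \<Rightarrow> nat \<Rightarrow> real" where
  "g_tilde N q e i r =
     (if i = 0 \<or> r = 0 then 0
      else if i = 1 then 0
      else if r = 1 then F_tilde q e i * w1 N q e (i - 1)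
      else F_tilde q e i * g_tilde N q e (i - 1) r
         + B_check q (i - 1) * g_tilde N q e i (r - 1)
         + (\<Sum>k = 1..r - 1. g_tilde N q e (i - 1) k * g_tilde N q e i (r - k)))"
  by pat_completeness auto
termination
  by (relation "measures [\<lambda>(N, q, e, i, r). i, \<lambda>(N, q, e, i, r). r]") auto

function h_seq :: "(nat \<Rightarrow> real) \<Rightarrow> (nat \<Rightarrow> real) \<Rightarrow> nat \<Rightarrow> nat \<Rightarrow> real" where
  "h_seq q e i p =
     (if i = 0 \<or> p = 0 then 0
      else if i = 1 then (if p = 1 then 1 / q 1 else 0)
      else if p = 1 then F_tilde q e i * h_seq q e (i - 1) 1 + 1 / q i
      else F_tilde q e i * (h_seq q e (i - 1) p + real p * h_seq q e (i - 1) 1 * h_seq q e (i - 1) (p - 1))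
         + (\<Sum>k = 1..p - 2. real (p choose k) * h_seq q e (i - 1) k * h_seq q e i (p - k)))"
  by pat_completeness auto
termination
  by (relation "measures [\<lambda>(q, e, i, p). i, \<lambda>(q, e, i, p). p]") auto

declare g_tilde.simps [simp del] h_seq.simps [simp del]

lemma g_tilde_rec:
  "r \<ge> 1 \<Longrightarrow> g_tilde N q e 1 r = 0"
  "i \<ge> 2 \<Longrightarrow> g_tilde N q e i 1 = F_tilde q e i * w1 N q e (i - 1)"
  "i \<ge> 2 \<Longrightarrow> r \<ge> 2 \<Longrightarrow> g_tilde N q e i r =
     F_tilde q e i * g_tilde N q e (i - 1) r
     + B_check q (i - 1) * g_tilde N q e i (r - 1)
     + (\<Sum>k = 1..r - 1. g_tilde N q e (i - 1) k * g_tilde N q e i (r - k))"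
  by (subst g_tilde.simps; simp)+

lemma h_seq_rec:
  "h_seq q e 1 1 = 1 / q 1"
  "i \<ge> 2 \<Longrightarrow> h_seq q e i 1 = F_tilde q e i * h_seq q e (i - 1) 1 + 1 / q i"
  "p \<ge> 2 \<Longrightarrow> h_seq q e 1 p = 0"
  "i \<ge> 2 \<Longrightarrow> p \<ge> 2 \<Longrightarrow> h_seq q e i p =
     F_tilde q e i * (h_seq q e (i - 1) p + real p * h_seq q e (i - 1) 1 * h_seq q e (i - 1) (p - 1))
     + (\<Sum>k = 1..p - 2. real (p choose k) * h_seq q e (i - 1) k * h_seq q e i (p - k))"
  by (subst h_seq.simps; simp)+

end

theory Submission
  imports Defs "Jordan_Normal_Form.Determinant"
begin

text \<open>
  Multiplying \<open>D * B = 1\<close> out by columns, where \<open>D\<close> is the inverse of the bidiagonal matrix \<open>B\<close>,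
  shows that the squared norms of the columns of \<open>D\<close>, which are the diagonal entries of
  \<open>(B * B\<^sup>T)\<^sup>-\<^sup>1 = D\<^sup>T * D\<close>, obey the recursion defining \<open>h_i\<^sup>(\<^sup>1\<^sup>)\<close>.
  Hence \<open>u_i\<^sup>(\<^sup>p\<^sup>) = h_i\<^sup>(\<^sup>p\<^sup>) / p!\<close> and \<open>g_i\<^sup>(\<^sup>p\<^sup>)\<close> differ for \<open>p = 1\<close> by exactly \<open>1 / q_i\<close>. Absorbing
  the term \<open>g_i\<^sup>(\<^sup>r\<^sup>-\<^sup>1\<^sup>) / q_(i-1)\<close> of the recursion for \<open>g\<close> into the summand \<open>k = 1\<close>, and splitting off
  the summand \<open>k = r - 1\<close>, turns it into the recursion for \<open>u\<close>.
\<close>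

lemma bidiag_carrier [simp]: "bidiag N q e \<in> carrier_mat N N"
  by (simp add: bidiag_def)

text \<open>The matrix is triangular, so its determinant is the product of the numbers
  \<open>sqrt (q i)\<close>, all nonzero.\<close>

lemma bidiag_inverse:
  assumes "\<forall>j\<in>{1..N}. q j > 0"
  obtains D where "D \<in> carrier_mat N N" "D * bidiag N q e = 1\<^sub>m N" "bidiag N q e * D = 1\<^sub>m N"
proof -
  let ?B = "bidiag N q e"
  have "upper_triangular ?B"
    by (auto simp: bidiag_def)
  then have "det ?B = prod_list (diag_mat ?B)"
    by (rule det_upper_triangular[OF _ bidiag_carrier])
  moreover have "q (Suc i) \<noteq> 0" if "i < N" for i
    using bspec[OF assms, of "Suc i"] that by simp
  ultimately have "det ?B \<noteq> 0"
    by (simp add: prod_list_diag_prod bidiag_def)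
  then have "?B \<in> Units (ring_mat TYPE(real) N ())"
    by (rule det_non_zero_imp_unit[OF bidiag_carrier])
  then show thesis
    by (auto simp: Units_def ring_mat_def intro: that)
qed

lemma w1_eq_column_norm:
  assumes D: "D \<in> carrier_mat N N" "D * bidiag N q e = 1\<^sub>m N" "bidiag N q e * D = 1\<^sub>m N"
    and i: "i \<in> {1..N}"
  shows "w1 N q e i = (\<Sum>k<N. (D $$ (k, i - 1))\<^sup>2)"
proof -
  let ?B = "bidiag N q e"
  define A where "A = ?B * transpose_mat ?B"
  have A: "A \<in> carrier_mat N N"
    unfolding A_def by (rule mult_carrier_mat[of _ N N]) auto
  define X where "X = transpose_mat D * D"
  have X: "X \<in> carrier_mat N N"
    unfolding X_def using D(1) by (intro mult_carrier_mat) auto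
  \<comment> \<open>Reassociating brings \<open>D\<close> next to \<open>?B\<close>; these cancel,
    and what remains is the transpose of \<open>?B * D = 1\<close>.\<close>
  have "X * A = transpose_mat D * (D * (?B * transpose_mat ?B))"
    unfolding X_def A_def using D(1) by (intro assoc_mult_mat[of _ N N _ N _ N] mult_carrier_mat[of _ N N]) auto
  also have "D * (?B * transpose_mat ?B) = (D * ?B) * transpose_mat ?B"
    using D(1) by (intro assoc_mult_mat[of _ N N _ N _ N, symmetric]) auto
  also have "\<dots> = transpose_mat ?B"
    unfolding D(2) by (rule left_mult_one_mat[of _ N N]) simp
  also have "transpose_mat D * transpose_mat ?B = transpose_mat (?B * D)"
    using D(1) by (intro transpose_mult[symmetric, of _ N N _ N]) auto
  finally have XA: "X * A = 1\<^sub>m N"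
    by (simp add: D(3))
  \<comment> \<open>Being a unit rules out the result \<open>None\<close>, so \<open>the\<close> in
    \<open>w1\<close> returns a genuine inverse \<open>Y\<close>; it equals \<open>X\<close> because
    a left and a right inverse coincide.\<close>
  have "A \<in> Units (ring_mat TYPE(real) N ())"
    using A X XA mat_mult_left_right_inverse[OF X A XA]
    by (auto simp: Units_def ring_mat_def)
  then obtain Y where Y: "mat_inverse A = Some Y"
    using mat_inverse(1)[OF A, of "()"] by (cases "mat_inverse A") auto
  from mat_inverse(2)[OF A Y] have "A * Y = 1\<^sub>m N" "Y \<in> carrier_mat N N"
    by auto
  then have "Y = X"
    using assoc_mult_mat[OF X A, of Y N] X XA by simp
  then have "w1 N q e i = X $$ (i - 1, i - 1)"
    using Y by (simp add: w1_def A_def)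
  also have "\<dots> = (\<Sum>k<N. (D $$ (k, i - 1))\<^sup>2)"
  proof -
    have "i - 1 < N" using i by auto
    then show ?thesis
      using D(1) by (simp add: X_def scalar_prod_def power2_eq_square lessThan_atLeast0)
  qed
  finally show ?thesis .
qed

text \<open>A column of the bidiagonal matrix is nonzero in at most two rows, so each entry of
  \<open>D * B = 1\<close> collapses to a sum of one or two terms.\<close>

lemma left_inverse_bidiag_columns:
  assumes D: "D \<in> carrier_mat N N" "D * bidiag N q e = 1\<^sub>m N"
    and k: "k < N"
  shows "0 < N \<Longrightarrow> D $$ (k, 0) * sqrt (q 1) = (if k = 0 then 1 else 0)"
    and "Suc j < N \<Longrightarrow> D $$ (k, Suc j) * sqrt (q (j + 2)) + D $$ (k, j) * sqrt (e (j + 1)) =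
           (if k = Suc j then 1 else 0)"
proof -
  have eq: "(\<Sum>l<N. D $$ (k, l) * bidiag N q e $$ (l, c)) = (if k = c then 1 else 0)"
    if "c < N" for c
  proof -
    have "(D * bidiag N q e) $$ (k, c) = (\<Sum>l<N. D $$ (k, l) * bidiag N q e $$ (l, c))"
      using D(1) k that by (simp add: scalar_prod_def lessThan_atLeast0 bidiag_def)
    then show ?thesis
      using D(2) k that by simp
  qed
  show "D $$ (k, 0) * sqrt (q 1) = (if k = 0 then 1 else 0)" if "0 < N"
  proof -
    have "(\<Sum>l<N. D $$ (k, l) * bidiag N q e $$ (l, 0)) = (\<Sum>l\<in>{0}. D $$ (k, l) * bidiag N q e $$ (l, 0))"
      using that by (intro sum.mono_neutral_right) (auto simp: bidiag_def)
    then show ?thesis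
      using eq[OF that] that by (simp add: bidiag_def)
  qed
  show "D $$ (k, Suc j) * sqrt (q (j + 2)) + D $$ (k, j) * sqrt (e (j + 1)) =
      (if k = Suc j then 1 else 0)" if "Suc j < N"
  proof -
    have "(\<Sum>l<N. D $$ (k, l) * bidiag N q e $$ (l, Suc j)) =
        (\<Sum>l\<in>{Suc j, j}. D $$ (k, l) * bidiag N q e $$ (l, Suc j))"
      using that by (intro sum.mono_neutral_right) (auto simp: bidiag_def)
    then show ?thesis
      using eq[OF that] that by (simp add: bidiag_def)
  qed
qed

text \<open>Left of the diagonal the column equations are homogeneous, so the zero in column 0
  propagates along row \<open>k\<close>. This serves to remove a cross term when those equations are
  squared.\<close>

lemma left_inverse_bidiag_upper:
  assumes D: "D \<in> carrier_mat N N" "D * bidiag N q e = 1\<^sub>m N"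
    and q: "\<forall>j\<in>{1..N}. q j > 0"
    and "k < N" "j < k"
  shows "D $$ (k, j) = 0"
  using \<open>j < k\<close>
proof (induction j)
  case 0
  with left_inverse_bidiag_columns(1)[OF D \<open>k < N\<close>] bspec[OF q, of 1] \<open>k < N\<close> show ?case
    by auto
next
  case (Suc j)
  with left_inverse_bidiag_columns(2)[OF D \<open>k < N\<close>, of j] bspec[OF q, of "j + 2"] \<open>k < N\<close> show ?case
    by auto
qed

lemma w1_rec:
  assumes q: "\<forall>j\<in>{1..N}. q j > 0"
    and e: "\<forall>j\<in>{1..N - 1}. e j > 0"
  shows "1 \<le> N \<Longrightarrow> w1 N q e 1 = 1 / q 1"
    and "Suc j < N \<Longrightarrow> w1 N q e (j + 2) = F_tilde q e (j + 2) * w1 N q e (j + 1) + 1 / q (j + 2)"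
proof -
  obtain D where D: "D \<in> carrier_mat N N" "D * bidiag N q e = 1\<^sub>m N" "bidiag N q e * D = 1\<^sub>m N"
    using bidiag_inverse[OF q] by blast
  note w1 = w1_eq_column_norm[OF D]
  note cols = left_inverse_bidiag_columns[OF D(1,2)]
  show "w1 N q e 1 = 1 / q 1" if "1 \<le> N"
  proof -
    have q1: "q 1 > 0" using q that by simp
    have "(D $$ (k, 0))\<^sup>2 = (if k = 0 then 1 / q 1 else 0)" if "k < N" for k
    proof -
      have "D $$ (k, 0) = (if k = 0 then 1 else 0) / sqrt (q 1)"
        using cols(1)[OF that] q1 that by (simp add: field_simps)
      then show ?thesis
        using q1 by (simp add: power_divide)
    qed
    then show ?thesis
      using w1[of 1] that by simp
  qed
  show "w1 N q e (j + 2) = F_tilde q e (j + 2) * w1 N q e (j + 1) + 1 / q (j + 2)"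
    if j: "Suc j < N"
  proof -
    have qj: "q (j + 2) > 0" and ej: "e (j + 1) > 0"
      using q e j by auto
    have sq: "(D $$ (k, Suc j))\<^sup>2 =
        e (j + 1) / q (j + 2) * (D $$ (k, j))\<^sup>2 + (if k = Suc j then 1 / q (j + 2) else 0)"
      if k: "k < N" for k
    proof -
      have col: "D $$ (k, Suc j) =
          ((if k = Suc j then 1 else 0) - D $$ (k, j) * sqrt (e (j + 1))) / sqrt (q (j + 2))"
        using cols(2)[OF k j] qj by (simp add: field_simps)
      show ?thesis
      \<comment> \<open>Squaring could leave a cross term only where the indicator is 1, that is for
        \<open>k = Suc j\<close>; there \<open>D $$ (k, j)\<close> lies below the diagonal and
        vanishes.\<close>
      proof (cases "k = Suc j")
        case True
        then have "D $$ (k, j) = 0"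
          using left_inverse_bidiag_upper[OF D(1,2) q k] by simp
        with True col qj show ?thesis
          by (simp add: power_divide)
      next
        case False
        with col qj ej show ?thesis
          by (simp add: power_divide power_mult_distrib)
      qed
    qed
    have "w1 N q e (j + 2) = (\<Sum>k<N. (D $$ (k, Suc j))\<^sup>2)"
      using w1[of "j + 2"] j by simp
    also have "\<dots> = (\<Sum>k<N. e (j + 1) / q (j + 2) * (D $$ (k, j))\<^sup>2
        + (if k = Suc j then 1 / q (j + 2) else 0))"
      by (intro sum.cong refl sq) simp
    also have "\<dots> = e (j + 1) / q (j + 2) * (\<Sum>k<N. (D $$ (k, j))\<^sup>2) + 1 / q (j + 2)"
      unfolding sum.distrib sum_distrib_left[symmetric] using j by simp
    also have "(\<Sum>k<N. (D $$ (k, j))\<^sup>2) = w1 N q e (j + 1)"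
      using w1[of "j + 1"] j by simp
    finally show ?thesis
      by (simp add: F_tilde_def)
  qed
qed

lemma w1_eq_h_seq:
  assumes q: "\<forall>j\<in>{1..N}. q j > 0"
    and e: "\<forall>j\<in>{1..N - 1}. e j > 0"
    and "j < N"
  shows "w1 N q e (Suc j) = h_seq q e (Suc j) 1"
  using \<open>j < N\<close>
proof (induction j)
  case 0
  then show ?case
    using w1_rec(1)[OF q e] h_seq_rec(1)[of q e] by simp
next
  case (Suc j)
  then show ?case
    using w1_rec(2)[OF q e, of j] h_seq_rec(2)[of "j + 2" q e] by simp
qed

text \<open>As with exponential generating functions, dividing by \<open>fact p\<close> turns the
  binomial convolution into a plain one, and \<open>p / fact p\<close> becomes
  \<open>1 / fact (p - 1)\<close>.\<close>

lemma h_seq_div_fact_rec: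
  assumes "i \<ge> 2" "p \<ge> 2"
  shows "h_seq q e i p / fact p =
     F_tilde q e i * (h_seq q e (i - 1) p / fact p
       + h_seq q e (i - 1) 1 * (h_seq q e (i - 1) (p - 1) / fact (p - 1)))
     + (\<Sum>k = 1..p - 2. h_seq q e (i - 1) k / fact k * (h_seq q e i (p - k) / fact (p - k)))"
proof -
  have "real (p choose k) * a * b / fact p = a / fact k * (b / fact (p - k))"
    if "k \<in> {1..p - 2}" for k a b
    using that binomial_fact[of k p, where 'a = real] by (cases "k \<le> p") auto
  then have sum: "(\<Sum>k = 1..p - 2. real (p choose k) * h_seq q e (i - 1) k * h_seq q e i (p - k)) / fact p
      = (\<Sum>k = 1..p - 2. h_seq q e (i - 1) k / fact k * (h_seq q e i (p - k) / fact (p - k)))"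
    unfolding sum_divide_distrib by (rule sum.cong[OF refl])
  have lin: "c * (x + real p * a * b) / fact p = c * (x / fact p + a * (b / fact (p - 1)))" for a b c x
    using assms(2) by (simp add: fact_reduce[of p] field_simps)
  show ?thesis
    unfolding h_seq_rec(4)[OF assms] sum[symmetric]
    by (subst add_divide_distrib) (simp only: lin)
qed

text \<open>Order 1 enters the convolutions of all higher orders, so its discrepancy is carried in
  the statement. The outer induction supplies the previous index at every order, the inner one the
  lower orders at the same index.\<close>

lemma h_seq_div_fact_eq_g_tilde:
  assumes q: "\<forall>j\<in>{1..N}. q j > 0"
    and e: "\<forall>j\<in>{1..N - 1}. e j > 0"
    and "j < N" "r \<ge> 1"
  shows "h_seq q e (Suc j) r / fact r =
    g_tilde N q e (Suc j) r + (if r = 1 then B_check q (Suc j) else 0)"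
  using \<open>j < N\<close> \<open>r \<ge> 1\<close>
proof (induction j arbitrary: r)
  case 0
  then show ?case
    by (cases "r = 1") (use h_seq_rec(1)[of q e] h_seq_rec(3)[of r q e] g_tilde_rec(1)[of r N q e] in \<open>simp_all add: B_check_def\<close>)
next
  case (Suc j)
  define u where "u i r = h_seq q e i r / fact r" for i r
  let ?g = "g_tilde N q e" and ?b = "B_check q" and ?F = "F_tilde q e (Suc (Suc j))"
  have w: "w1 N q e (Suc j) = u (Suc j) 1"
    using w1_eq_h_seq[OF q e, of j] Suc.prems by (simp add: u_def)
  have IH: "u (Suc j) k = ?g (Suc j) k + (if k = 1 then ?b (Suc j) else 0)" if "k \<ge> 1" for k
    using Suc.IH[of k] Suc.prems(1) that by (simp add: u_def)
  have g1: "?g (Suc (Suc j)) 1 = ?F * u (Suc j) 1"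
    using g_tilde_rec(2)[of "Suc (Suc j)" N q e] w by simp
  have "u (Suc (Suc j)) r = ?g (Suc (Suc j)) r + (if r = 1 then ?b (Suc (Suc j)) else 0)"
    using \<open>r \<ge> 1\<close>
  proof (induction r rule: less_induct)
    case (less r)
    show ?case
    proof (cases "r = 1")
      case True
      then show ?thesis
        using g1 h_seq_rec(2)[of "Suc (Suc j)" q e] by (simp add: u_def B_check_def)
    next
      case False
      then obtain s where r: "r = Suc (Suc s)"
        using less.prems that[of "r - 2"] by simp
      \<comment> \<open>For \<open>k = 1\<close> the second factor has order
        \<open>r - 1 = Suc s\<close>, so the extra term joins that summand; by \<open>IH\<close> the
        correction turns \<open>?g (Suc j) 1\<close> into \<open>u (Suc j) 1\<close>.\<close>
      have "?b (Suc j) * ?g (Suc (Suc j)) (Suc s)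
          + (\<Sum>k = 1..Suc s. ?g (Suc j) k * ?g (Suc (Suc j)) (r - k))
          = (\<Sum>k = 1..Suc s. (if k = 1 then ?b (Suc j) * ?g (Suc (Suc j)) (r - k) else 0)
              + ?g (Suc j) k * ?g (Suc (Suc j)) (r - k))"
        by (simp add: sum.distrib r)
      also have "\<dots> = (\<Sum>k = 1..Suc s. u (Suc j) k * ?g (Suc (Suc j)) (r - k))"
        by (rule sum.cong) (auto simp: IH algebra_simps)
      \<comment> \<open>In the summand \<open>k = Suc s\<close> the second factor has order 1, and
        \<open>g1\<close> rewrites it as \<open>?F * u (Suc j) 1\<close>: this is the product term
        in the recursion for \<open>u\<close>.\<close>
      also have "\<dots> = (\<Sum>k = 1..s. u (Suc j) k * ?g (Suc (Suc j)) (r - k))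
          + ?F * (u (Suc j) 1 * u (Suc j) (Suc s))"
        using g1 by (simp add: r)
      \<comment> \<open>For \<open>k\<close> from 1 to \<open>s\<close> the order
        \<open>r - k\<close> is below \<open>r\<close> and at least 2, so the inner hypothesis
        applies without correction.\<close>
      also have "(\<Sum>k = 1..s. u (Suc j) k * ?g (Suc (Suc j)) (r - k))
          = (\<Sum>k = 1..s. u (Suc j) k * u (Suc (Suc j)) (r - k))"
        by (rule sum.cong) (use r in \<open>auto simp: less.IH Suc_diff_le\<close>)
      finally show ?thesis
        using g_tilde_rec(3)[of "Suc (Suc j)" r N q e] IH[of r]
          h_seq_div_fact_rec[of "Suc (Suc j)" r q e, folded u_def]
        by (simp add: r algebra_simps u_def[of _ "Suc 0"])
    qed
  qed
  then show ?case
    by (simp add: u_def)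
qed

theorem theorem14:
  fixes N :: nat and q e :: "nat \<Rightarrow> real" and i M :: nat
  assumes "N \<ge> 1"
    and "\<And>j. j \<in> {1..N} \<Longrightarrow> q j > 0"
    and "\<And>j. j \<in> {1..N - 1} \<Longrightarrow> e j > 0"
    and "i \<in> {1..N}"
    and "M \<ge> 2"
  shows "h_seq q e i M = fact M * g_tilde N q e i M"
proof -
  \<comment> \<open>The correction is absent because \<open>M\<close> is at least 2.\<close>
  have "h_seq q e i M / fact M = g_tilde N q e i M"
    using h_seq_div_fact_eq_g_tilde[of N q e "i - 1" M] assms by (auto simp: Suc_diff_Suc)
  then show ?thesis
    by (simp add: field_simps)
qed

end
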